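(* For any $w,u\in\mathfrak{S}_n$, the map \[ \mathcal{L}(P_{\{\mathrm{id},w,wu\}})\to\mathcal{L}(P_w)\times\mathcal{L}(wP_u),\qquad \lambda\mapsto\big(f_{P_w}(\pi_\lambda),\,f_{wP_u}(\pi_\lambda)\big) \] is injective.
   Context: For $U\subseteq\mathfrak{S}_n$, $P_U$ is the poset on elements $p_1,\dots,p_n$ with $p_i<p_j$ ($i\ne j$) iff $u^{-1}(i)<u^{-1}(j)$ for all $u\in U$. Write $P_w=P_{\{\mathrm{id},w\}}$ and $wP_u=P_{\{w,wu\}}$ (the poset $P_u$ with labels permuted by $w$: $p_{w(i)}<p_{w(j)}$ iff $p_i<p_j$ in $P_u$). A linear extension of an $n$-element poset $P$ is an order-preserving bijection $P\to[n]$; $\mathcal{L}(P)$ is the set of them; $\pi_\lambda\in\mathfrak{S}_n$ is defined by $\pi_\lambda(i)=j$ iff $\lambda(p_j)=i$. For a poset $P$ on $p_1,\dots,p_n$, the insertion map $f_P:\mathfrak{S}_n\to\mathcal{L}(P)$ is defined as follows for $x\in\mathfrak{S}_n$: for $k=1,2,\dots,n$ in turn, set $\lambda(p_{x(k)})=k$; then, while the element $p_a$ with $\lambda(p_a)=k$ is not maximal in the induced subposet of $P$ on $\{p_{x(1)},\dots,p_{x(k)}\}$, let $p_b$ be the element with the smallest already-defined value $\lambda(p_b)$ among those with $p_b>_P p_a$, and swap the values of $p_a$ and $p_b$. After step $n$, $\lambda$ is a linear extension of $P$ and $f_P(x)=\lambda$. *)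

theory Defs
  imports "HOL-Combinatorics.Permutations" "HOL-Library.FuncSet" "HOL-Library.While_Combinator"
begin

text \<open>
  The element \<open>p\<^sub>i\<close> is represented by its index \<open>i \<in> {1..n}\<close>, and a poset on \<open>p\<^sub>1, \<dots>, p\<^sub>n\<close> by its
  strict order relation, a subset of \<open>{1..n} \<times> {1..n}\<close>.  Permutations are functions \<open>nat \<Rightarrow> nat\<close>
  that permute \<open>{1..n}\<close>; the product \<open>w u\<close> is \<open>w \<circ> u\<close>.
\<close>

definition perm_poset :: "nat \<Rightarrow> (nat \<Rightarrow> nat) set \<Rightarrow> (nat \<times> nat) set" where
  "perm_poset n U =
     {(i, j). i \<in> {1..n} \<and> j \<in> {1..n} \<and> i \<noteq> j \<and> (\<forall>u\<in>U. inv u i < inv u j)}"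

text \<open>
  A bijection from the elements to \<open>{1..n}\<close> is normalised to be the identity outside \<open>{1..n}\<close>,
  so that equality of functions is equality of linear extensions.
\<close>

definition linear_extensions :: "nat \<Rightarrow> (nat \<times> nat) set \<Rightarrow> (nat \<Rightarrow> nat) set" where
  "linear_extensions n P =
     {lam. lam permutes {1..n} \<and> (\<forall>(i, j)\<in>P. lam i < lam j)}"

definition perm_of_ext :: "(nat \<Rightarrow> nat) \<Rightarrow> nat \<Rightarrow> nat" where
  "perm_of_ext lam = inv lam"

text \<open>
  In the state \<open>(a, lam)\<close> of the \<open>k\<close>-th insertion, \<open>a\<close> is the element with \<open>lam a = k\<close>, and
  \<open>S = x ` {1..k}\<close> is the set of elements whose value is already defined.
\<close>

definition insertion_swap ::
  "(nat \<times> nat) set \<Rightarrow> nat set \<Rightarrow> nat \<times> (nat \<Rightarrow> nat) \<Rightarrow> nat \<times> (nat \<Rightarrow> nat)" where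
  "insertion_swap P S = (\<lambda>(a, lam).
     let b = arg_min_on lam {b \<in> S. (a, b) \<in> P}
     in (b, lam(a := lam b, b := lam a)))"

definition insert_elem ::
  "(nat \<times> nat) set \<Rightarrow> nat set \<Rightarrow> nat \<Rightarrow> nat \<Rightarrow> (nat \<Rightarrow> nat) \<Rightarrow> nat \<Rightarrow> nat" where
  "insert_elem P S a k lam =
     snd (while (\<lambda>(a, lam). \<exists>b\<in>S. (a, b) \<in> P) (insertion_swap P S) (a, lam(a := k)))"

text \<open>
  The values of the initial \<open>id\<close> at elements of \<open>{1..n}\<close> are placeholders for ``not yet defined'':
  they are never read, and all of them are overwritten after \<open>n\<close> steps.
\<close>

primrec insertion_upto :: "(nat \<times> nat) set \<Rightarrow> (nat \<Rightarrow> nat) \<Rightarrow> nat \<Rightarrow> nat \<Rightarrow> nat" where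
  "insertion_upto P x 0 = id"
| "insertion_upto P x (Suc k) =
     insert_elem P (x ` {1..Suc k}) (x (Suc k)) (Suc k) (insertion_upto P x k)"

definition insertion_map :: "nat \<Rightarrow> (nat \<times> nat) set \<Rightarrow> (nat \<Rightarrow> nat) \<Rightarrow> nat \<Rightarrow> nat" where
  "insertion_map n P x = insertion_upto P x n"

lemma perm_poset_strict_order:
  assumes "U \<noteq> {}"
  shows "irrefl (perm_poset n U)" "trans (perm_poset n U)"
proof -
  show "irrefl (perm_poset n U)"
    by (auto simp: perm_poset_def irrefl_def)
  obtain v where v: "v \<in> U" using assms by blast
  show "trans (perm_poset n U)"
  proof (rule transI)
    fix i j k assume ij: "(i, j) \<in> perm_poset n U" and jk: "(j, k) \<in> perm_poset n U"
    then have lt: "\<forall>u\<in>U. inv u i < inv u k"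
      unfolding perm_poset_def by fastforce
    with v have "i \<noteq> k" by auto
    with lt ij jk show "(i, k) \<in> perm_poset n U"
      unfolding perm_poset_def by auto
  qed
qed

lemma perm_poset_translate:
  assumes w: "w permutes {1..n}" and u: "u permutes {1..n}"
  shows "(w i, w j) \<in> perm_poset n {w, w \<circ> u} \<longleftrightarrow> (i, j) \<in> perm_poset n {id, u}"
proof -
  have "inv (w \<circ> u) (w i) = inv u i" for i
    using permutes_inverses(2)[OF w] o_inv_distrib[OF permutes_bij[OF w] permutes_bij[OF u]]
    by simp
  then show ?thesis
    using permutes_inverses(2)[OF w] permutes_in_image[OF w] injD[OF permutes_inj[OF w]]
    unfolding perm_poset_def by auto
qed

end

theory Submission
  imports Defs
begin

text \<open>
  A single swap of the insertion algorithm can be undone: if the top value moved to \<open>b\<close>, it came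
  from the element below \<open>b\<close> whose value is now largest.  Hence if inserting \<open>a\<close> last and inserting
  \<open>c\<close> last produce the same labelling, then \<open>a = c\<close> and the labellings before were equal, or \<open>a\<close>
  and \<open>c\<close> are comparable in the poset.  The linear order given by \<open>w\<close> extends both \<open>P\<^sub>w\<close> and \<open>wP\<^sub>u\<close>,
  so elements comparable in both posets are comparable in their intersection \<open>P\<^bsub>{id,w,wu}\<^esub>\<close>.
  But the last inserted element is maximal in the intersection, so it is determined by the two
  labellings, and one recovers the insertion order by going backwards.
\<close>

section \<open>Single swaps and their reversal\<close>

locale strict_order =
  fixes P :: "(nat \<times> nat) set"
  assumes trans_P: "trans P" and irrefl_P: "irrefl P"
begin

text \<open>Loop invariant of one insertion: only pairs whose lower element is the token
  \<open>a\<close>, which holds the top value, may be out of order. The exemption becomes void once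
  \<open>a\<close> is maximal in \<open>S\<close>.\<close>

definition token_state :: "nat set \<Rightarrow> nat \<Rightarrow> nat \<times> (nat \<Rightarrow> nat) \<Rightarrow> bool" where
  "token_state S k = (\<lambda>(a, lam).
     a \<in> S \<and> bij_betw lam S {1..k} \<and> lam a = k \<and>
     (\<forall>y\<in>S. \<forall>z\<in>S. (y, z) \<in> P \<longrightarrow> y \<noteq> a \<longrightarrow> lam y < lam z))"

text \<open>The loop body as a relation on states satisfying the invariant, so that runs can be
  followed backwards through its converse.\<close>

definition swap_rel :: "nat set \<Rightarrow> nat \<Rightarrow> (nat \<times> (nat \<Rightarrow> nat)) rel" where
  "swap_rel S k = {(s, t). token_state S k s \<and> (\<exists>b\<in>S. (fst s, b) \<in> P) \<and> t = insertion_swap P S s}"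

lemma swap_relE:
  assumes "finite S" and "((a, lam), t) \<in> swap_rel S k"
  obtains b where "b \<in> S" "(a, b) \<in> P" "\<And>z. z \<in> S \<Longrightarrow> (a, z) \<in> P \<Longrightarrow> lam b \<le> lam z"
    "t = (b, lam(a := lam b, b := k))"
proof -
  let ?A = "{b \<in> S. (a, b) \<in> P}"
  let ?b = "arg_min_on lam ?A"
  have fin: "finite ?A" and ne: "?A \<noteq> {}"
    using assms by (auto simp: swap_rel_def)
  show thesis
  proof
    show "?b \<in> S" "(a, ?b) \<in> P"
      using arg_min_if_finite(1)[OF fin ne, of lam] by auto
    show "lam ?b \<le> lam z" if "z \<in> S" "(a, z) \<in> P" for z
      using arg_min_least[OF fin ne] that by auto
    show "t = (?b, lam(a := lam ?b, ?b := k))"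
      using assms(2) by (auto simp: swap_rel_def insertion_swap_def Let_def token_state_def)
  qed
qed

text \<open>The old token receives the least value found above it, which repairs the pairs starting
  there. Whatever lies below it also lies below \<open>b\<close> by transitivity, hence already had
  a value less than \<open>lam b\<close>.\<close>

lemma swap_rel_token_state:
  assumes "finite S" and st: "(s, t) \<in> swap_rel S k"
  shows "token_state S k t"
proof -
  obtain a lam where s: "s = (a, lam)" by force
  obtain b where b: "b \<in> S" "(a, b) \<in> P" "\<And>z. z \<in> S \<Longrightarrow> (a, z) \<in> P \<Longrightarrow> lam b \<le> lam z"
    and t: "t = (b, lam(a := lam b, b := k))"
    using swap_relE assms s by metis
  have a: "a \<in> S" and bij: "bij_betw lam S {1..k}" and ka: "lam a = k"
    and mono: "\<And>y z. y \<in> S \<Longrightarrow> z \<in> S \<Longrightarrow> (y, z) \<in> P \<Longrightarrow> y \<noteq> a \<Longrightarrow> lam y < lam z"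
    using st s by (auto simp: swap_rel_def token_state_def)
  have "a \<noteq> b" using b irrefl_P by (auto simp: irrefl_def)
  have inj: "lam y = lam z \<longleftrightarrow> y = z" if "y \<in> S" "z \<in> S" for y z
    using bij that by (auto simp: bij_betw_def inj_on_def)
  have lt: "lam y < k" if "y \<in> S" "y \<noteq> a" for y
    using bij_betwE[OF bij] that inj[of y a] a ka by (metis atLeastAtMost_iff le_neq_implies_less)
  let ?mu = "lam(a := lam b, b := k)"
  have "?mu = lam \<circ> transpose a b"
    using ka \<open>a \<noteq> b\<close> by (auto simp: fun_eq_iff transpose_def)
  moreover have "bij_betw (transpose a b) S S"
    using a b(1) by (simp add: bij_betw_transpose_iff)
  ultimately have "bij_betw ?mu S {1..k}"
    using bij bij_betw_trans by metis
  moreover have "?mu y < ?mu z" if yz: "y \<in> S" "z \<in> S" "(y, z) \<in> P" "y \<noteq> b" for y z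
  proof -
    have "y \<noteq> z" using yz irrefl_P by (auto simp: irrefl_def)
    consider "z = b" | "z = a" | "y = a" "z \<noteq> b" | "y \<noteq> a" "z \<noteq> a" "z \<noteq> b" by blast
    then show ?thesis
    proof cases
      case 1
      then show ?thesis using lt yz b \<open>a \<noteq> b\<close> by auto
    next
      case 2
      then have "(y, b) \<in> P" using yz b trans_P by (blast dest: transD)
      then show ?thesis using 2 mono[of y b] yz b \<open>a \<noteq> b\<close> \<open>y \<noteq> z\<close> by auto
    next
      case 3
      then show ?thesis using b(3)[of z] yz inj[of b z] b(1) \<open>y \<noteq> z\<close> \<open>a \<noteq> b\<close>
        by (auto simp: order_le_less)
    next
      case 4
      then show ?thesis using mono yz by auto
    qed
  qed
  ultimately show ?thesis using b(1) t by (auto simp: token_state_def)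
qed

lemma swap_rel_less:
  assumes "finite S" and "(s, t) \<in> swap_rel S k"
  shows "(fst s, fst t) \<in> P"
proof -
  obtain a lam where "s = (a, lam)" by force
  with assms(2) show ?thesis by (auto elim: swap_relE[OF assms(1)])
qed

lemma swap_rel_outside:
  assumes "finite S" and "(s, t) \<in> swap_rel S k" and "y \<notin> S"
  shows "snd t y = snd s y"
proof -
  have "fst s \<in> S" using assms(2) by (auto simp: swap_rel_def token_state_def)
  with assms(2,3) show ?thesis
    by (cases s) (auto elim!: swap_relE[OF assms(1)])
qed

lemma swap_rel_backward_deterministic:
  assumes fin: "finite S"
  shows "single_valued ((swap_rel S k)\<inverse>)"
proof -
  \<comment> \<open>The swap leaves the value of \<open>c\<close> unchanged, and the invariant puts
    it below \<open>lam b\<close>, which is now the value of \<open>a\<close>. Used in both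
    directions, this forces \<open>nu a = nu c\<close>.\<close>
  have le: "nu c \<le> nu a"
    if l: "((a, lam), (b, nu)) \<in> swap_rel S k" and m: "((c, mu), (b, nu)) \<in> swap_rel S k"
    for a c b lam mu nu
  proof (cases "c = a")
    case False
    have c: "c \<in> S" "(c, b) \<in> P"
      using swap_rel_less[OF fin m] m by (auto simp: swap_rel_def token_state_def)
    have b: "b \<in> S" "(a, b) \<in> P" and nu: "nu = lam(a := lam b, b := k)"
      using l by (auto elim!: swap_relE[OF fin])
    have "lam c < lam b"
      using l c b False by (auto simp: swap_rel_def token_state_def)
    then show ?thesis using False nu c(2) b(2) irrefl_P by (auto simp: irrefl_def)
  qed simp
  have "a = c \<and> lam = mu"
    if l: "((a, lam), (b, nu)) \<in> swap_rel S k" and m: "((c, mu), (b, nu)) \<in> swap_rel S k"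
    for a c b lam mu nu
  proof -
    have "a \<in> S" "c \<in> S" using l m by (auto simp: swap_rel_def token_state_def)
    moreover have "inj_on nu S"
      using swap_rel_token_state[OF fin l] by (auto simp: token_state_def bij_betw_def)
    ultimately have ac: "a = c" using le[OF l m] le[OF m l] by (auto dest: inj_onD)
    have ka: "lam a = k" "mu c = k" using l m by (auto simp: swap_rel_def token_state_def)
    have nu: "nu = lam(a := lam b, b := k)" "nu = mu(c := mu b, b := k)"
      using l m by (auto elim!: swap_relE[OF fin])
    have "a \<noteq> b" using swap_rel_less[OF fin l] irrefl_P by (auto simp: irrefl_def)
    then have "lam = nu(a := k, b := nu a)"
      using ka nu(1) by (auto simp: fun_eq_iff)
    moreover have "mu = nu(a := k, b := nu a)"
      using \<open>a \<noteq> b\<close> ac ka nu(2) by (auto simp: fun_eq_iff)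
    ultimately show ?thesis using ac by simp
  qed
  then show ?thesis
    by (intro single_valuedI) auto
qed

section \<open>Inserting one element\<close>

definition labelling :: "nat set \<Rightarrow> nat \<Rightarrow> (nat \<Rightarrow> nat) \<Rightarrow> bool" where
  "labelling S k lam \<longleftrightarrow> bij_betw lam S {1..k} \<and> (\<forall>y. y \<notin> S \<longrightarrow> lam y = y) \<and>
     (\<forall>y\<in>S. \<forall>z\<in>S. (y, z) \<in> P \<longrightarrow> lam y < lam z)"

lemma token_state_insert:
  assumes "labelling S k lam" and "a \<notin> S"
  shows "token_state (insert a S) (Suc k) (a, lam(a := Suc k))"
proof -
  have bij: "bij_betw lam S {1..k}" using assms by (simp add: labelling_def)
  have "bij_betw (lam(a := Suc k)) S {1..k}"
    using bij assms(2) by (subst bij_betw_cong[where g = lam]) auto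
  then have "bij_betw (lam(a := Suc k)) (insert a S) (insert (Suc k) {1..k})"
    using assms(2) notIn_Un_bij_betw[of a S "lam(a := Suc k)" "{1..k}"] by simp
  moreover have "insert (Suc k) {1..k} = {1..Suc k}" by auto
  moreover have "lam y < Suc k" if "y \<in> S" for y
    using bij_betwE[OF bij] that by (auto simp: less_Suc_eq_le)
  ultimately show ?thesis
    using assms by (auto simp: token_state_def labelling_def)
qed

text \<open>Turns the \<open>while\<close> loop into a chain of swaps that stops at a maximal token,
  the form needed for reversing it.\<close>

lemma insert_elem_swaps:
  assumes fin: "finite S" and init: "token_state S k (a, lam(a := k))"
  obtains b where "((a, lam(a := k)), (b, insert_elem P S a k lam)) \<in> (swap_rel S k)\<^sup>*"
    and "token_state S k (b, insert_elem P S a k lam)" and "\<not> (\<exists>c\<in>S. (b, c) \<in> P)"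
proof -
  let ?s = "(a, lam(a := k))"
  let ?cond = "\<lambda>(a :: nat, lam :: nat \<Rightarrow> nat). \<exists>b\<in>S. (a, b) \<in> P"
  let ?t = "while ?cond (insertion_swap P S) ?s"
  let ?I = "\<lambda>s. token_state S k s \<and> (?s, s) \<in> (swap_rel S k)\<^sup>*"
  have step: "(s, insertion_swap P S s) \<in> swap_rel S k" if "?I s" "?cond s" for s
    using that by (auto simp: swap_rel_def)
  have "?I ?t \<and> \<not> ?cond ?t"
  proof (rule while_rule[where P = ?I and r = "measure (\<lambda>s. card {b \<in> S. (fst s, b) \<in> P})"])
    fix s assume s: "?I s" "?cond s"
    note st = step[OF s]
    show "?I (insertion_swap P S s)"
      using s(1) swap_rel_token_state[OF fin st] st by (auto intro: rtrancl_into_rtrancl)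
    let ?t = "insertion_swap P S s"
    have lt: "(fst s, fst ?t) \<in> P" using swap_rel_less[OF fin st] .
    have tS: "fst ?t \<in> S"
      using swap_rel_token_state[OF fin st] by (auto simp: token_state_def split: prod.splits)
    \<comment> \<open>Termination: transitivity gives the inclusion, and the new token itself makes
      it strict.\<close>
    have "{b \<in> S. (fst ?t, b) \<in> P} \<subset> {b \<in> S. (fst s, b) \<in> P}"
      using lt tS trans_P irrefl_P by (auto simp: irrefl_def dest: transD)
    then show "(?t, s) \<in> measure (\<lambda>s. card {b \<in> S. (fst s, b) \<in> P})"
      using fin by (auto intro!: psubset_card_mono)
  qed (use init in \<open>auto simp del: fun_upd_apply\<close>)
  moreover have "?t = (fst ?t, insert_elem P S a k lam)"
    by (simp add: insert_elem_def)
  ultimately show thesis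
    using that[of "fst ?t"] by (metis (mono_tags, lifting) case_prod_conv)
qed

text \<open>The final token is maximal, so the invariant holds without its exemption; swaps never
  touch values outside the inserted set.\<close>

lemma labelling_insert_elem:
  assumes "finite S" and lam: "labelling S k lam" and a: "a \<notin> S"
  shows "labelling (insert a S) (Suc k) (insert_elem P (insert a S) a (Suc k) lam)"
proof -
  let ?S = "insert a S" and ?mu = "insert_elem P (insert a S) a (Suc k) lam"
  have fin: "finite ?S" using assms(1) by simp
  obtain b where path: "((a, lam(a := Suc k)), (b, ?mu)) \<in> (swap_rel ?S (Suc k))\<^sup>*"
    and b: "token_state ?S (Suc k) (b, ?mu)" "\<not> (\<exists>c\<in>?S. (b, c) \<in> P)"
    using insert_elem_swaps[OF fin token_state_insert[OF lam a]] .
  have "snd t y = snd s y" if "(s, t) \<in> (swap_rel ?S (Suc k))\<^sup>*" "y \<notin> ?S" for s t y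
    using that by (induction rule: rtrancl_induct) (auto dest: swap_rel_outside[OF fin])
  from this[OF path] have "?mu y = y" if "y \<notin> ?S" for y
    using lam that by (auto simp: labelling_def)
  moreover have "?mu y < ?mu z" if "y \<in> ?S" "z \<in> ?S" "(y, z) \<in> P" for y z
  proof -
    have "y \<noteq> b" using b(2) that by blast
    then show ?thesis using b(1) that unfolding token_state_def by blast
  qed
  ultimately show ?thesis
    using b(1) by (simp add: token_state_def labelling_def)
qed

text \<open>Equal results force equal final states, since the token is the element with value
  \<open>Suc k\<close>. Following both runs backwards, one starting state occurs in the run of the
  other, and swaps only move the token upwards in \<open>P\<close>.\<close>

lemma insert_elem_eq_cases:
  assumes "finite S" "finite S'" and lam: "labelling S k lam" and mu: "labelling S' k mu"
    and "a \<notin> S" "c \<notin> S'" and S: "insert a S = insert c S'"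
    and eq: "insert_elem P (insert a S) a (Suc k) lam = insert_elem P (insert c S') c (Suc k) mu"
  shows "a = c \<and> lam = mu \<or> (a, c) \<in> P \<or> (c, a) \<in> P"
proof -
  let ?S = "insert a S"
  let ?R = "swap_rel ?S (Suc k)"
  let ?s = "(a, lam(a := Suc k))" and ?t = "(c, mu(c := Suc k))"
  let ?nu = "insert_elem P ?S a (Suc k) lam"
  have fin: "finite ?S" using assms(1) by simp
  obtain b where b: "(?s, (b, ?nu)) \<in> ?R\<^sup>*" "token_state ?S (Suc k) (b, ?nu)"
    using insert_elem_swaps[OF fin token_state_insert[OF lam \<open>a \<notin> S\<close>]] .
  have "token_state ?S (Suc k) ?t"
    using token_state_insert[OF mu \<open>c \<notin> S'\<close>] S by simp
  from insert_elem_swaps[OF fin this]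
  obtain b' where b': "(?t, (b', ?nu)) \<in> ?R\<^sup>*" "token_state ?S (Suc k) (b', ?nu)"
    using eq S by metis
  have "inj_on ?nu ?S" "b \<in> ?S" "b' \<in> ?S" "?nu b = ?nu b'"
    using b(2) b'(2) by (simp_all add: token_state_def bij_betw_def)
  then have "b = b'" by (meson inj_onD)
  \<comment> \<open>Two chains of a single-valued relation from a common point are nested; here the
    relation is the converse of \<open>?R\<close>.\<close>
  then have comp: "(?s, ?t) \<in> ?R\<^sup>* \<or> (?t, ?s) \<in> ?R\<^sup>*"
    using b(1) b'(1) single_valued_confluent[OF swap_rel_backward_deterministic[OF fin]]
    by (metis rtrancl_converseI rtrancl_converseD)
  have less: "s = t \<or> (fst s, fst t) \<in> P" if "(s, t) \<in> ?R\<^sup>*" for s t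
    using that
  proof (induction rule: rtrancl_induct)
    case (step t v)
    then show ?case using swap_rel_less[OF fin step.hyps(2)] transD[OF trans_P] by blast
  qed simp
  have eq: "a = c \<and> lam = mu" if "?s = ?t"
  proof -
    \<comment> \<open>Restoring the placeholder value at the new element undoes the initial
      assignment of \<open>Suc k\<close>, giving equality as functions.\<close>
    have "lam a = a" "mu c = c"
      using lam mu \<open>a \<notin> S\<close> \<open>c \<notin> S'\<close> by (simp_all add: labelling_def)
    then have "lam = (snd ?s)(a := a)" "mu = (snd ?t)(c := c)" by auto
    then show ?thesis using that by (metis fst_conv)
  qed
  from comp have "?s = ?t \<or> (a, c) \<in> P \<or> (c, a) \<in> P"
    by (metis less fst_conv)
  then show ?thesis using eq by blast
qed

section \<open>Inserting a whole permutation, into one poset and then into two\<close>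

lemma image_atLeastAtMost_Suc: "x ` {1..Suc k} = insert (x (Suc k)) (x ` {1..k})"
  by (simp add: atLeastAtMostSuc_conv)

lemma labelling_insertion_upto:
  assumes "inj x"
  shows "labelling (x ` {1..k}) k (insertion_upto P x k)"
proof (induction k)
  case 0
  then show ?case by (simp add: labelling_def bij_betw_def)
next
  case (Suc k)
  have "x (Suc k) \<notin> x ` {1..k}" using assms by (auto simp: inj_eq)
  then show ?case
    using labelling_insert_elem[OF _ Suc] by (simp add: image_atLeastAtMost_Suc del: One_nat_def)
qed

lemma insertion_map_linear_extension:
  assumes "x permutes {1..n}" and "P \<subseteq> {1..n} \<times> {1..n}"
  shows "insertion_map n P x \<in> linear_extensions n P"
proof -
  have "labelling {1..n} n (insertion_map n P x)"
    using labelling_insertion_upto[OF permutes_inj[OF assms(1)], of n] permutes_image[OF assms(1)]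
    by (simp add: insertion_map_def)
  then show ?thesis
    using assms(2) by (auto simp: labelling_def linear_extensions_def intro: bij_imp_permutes)
qed

lemma insertion_upto_Suc_eq_cases:
  assumes "inj x" "inj y" and "x ` {1..Suc k} = y ` {1..Suc k}"
    and "insertion_upto P x (Suc k) = insertion_upto P y (Suc k)"
  shows "x (Suc k) = y (Suc k) \<and> insertion_upto P x k = insertion_upto P y k
    \<or> (x (Suc k), y (Suc k)) \<in> P \<or> (y (Suc k), x (Suc k)) \<in> P"
proof (rule insert_elem_eq_cases)
  show "labelling (x ` {1..k}) k (insertion_upto P x k)"
    "labelling (y ` {1..k}) k (insertion_upto P y k)"
    using assms labelling_insertion_upto by auto
  show "x (Suc k) \<notin> x ` {1..k}" "y (Suc k) \<notin> y ` {1..k}"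
    using assms(1,2) by (auto simp: inj_eq)
qed (use assms in \<open>simp_all add: image_atLeastAtMost_Suc del: One_nat_def\<close>)

end

text \<open>If the last elements differed, they would be comparable in both posets:
  \<open>disj\<close> excludes opposite directions, and the order of insertion excludes equal ones.
  So they coincide, irreflexivity leaves only the first alternative of the one-step lemma for
  \<open>P\<close> and for \<open>Q\<close>, and the induction descends.\<close>

lemma insertion_upto_pair_inj:
  assumes P: "strict_order P" and Q: "strict_order Q"
    and disj: "\<And>a b. (a, b) \<in> P \<Longrightarrow> (b, a) \<notin> Q"
    and x: "inj x" "\<And>i j. (x i, x j) \<in> P \<inter> Q \<Longrightarrow> i < j"
    and y: "inj y" "\<And>i j. (y i, y j) \<in> P \<inter> Q \<Longrightarrow> i < j"
    and "x ` {1..k} = y ` {1..k}"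
    and "insertion_upto P x k = insertion_upto P y k"
    and "insertion_upto Q x k = insertion_upto Q y k"
    and "i \<in> {1..k}"
  shows "x i = y i"
  using assms(8-)
proof (induction k)
  case (Suc k)
  let ?a = "x (Suc k)" and ?c = "y (Suc k)"
  \<comment> \<open>By equality of the images, \<open>g (Suc k)\<close> is some \<open>f j\<close>
    with \<open>j \<le> Suc k\<close>, whereas lying above \<open>f (Suc k)\<close> would require
    \<open>j > Suc k\<close>.\<close>
  have aux: "(f (Suc k), g (Suc k)) \<notin> P \<inter> Q"
    if f: "\<And>i j. (f i, f j) \<in> P \<inter> Q \<Longrightarrow> i < j" and fg: "f ` {1..Suc k} = g ` {1..Suc k}"
    for f g :: "nat \<Rightarrow> nat"
  proof
    assume less: "(f (Suc k), g (Suc k)) \<in> P \<inter> Q"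
    have "g (Suc k) \<in> f ` {1..Suc k}" using fg by simp
    then obtain j where "j \<le> Suc k" "g (Suc k) = f j" by auto
    with less f[of "Suc k" j] show False by auto
  qed
  have "(?a, ?c) \<notin> P \<inter> Q" "(?c, ?a) \<notin> P \<inter> Q"
    using aux[OF x(2)] aux[OF y(2)] Suc.prems(1) by auto
  then have eq: "?a = ?c \<and> insertion_upto P x k = insertion_upto P y k
      \<and> insertion_upto Q x k = insertion_upto Q y k"
    using strict_order.insertion_upto_Suc_eq_cases[OF P x(1) y(1) Suc.prems(1,2)]
      strict_order.insertion_upto_Suc_eq_cases[OF Q x(1) y(1) Suc.prems(1,3)]
      disj P Q by (auto simp: strict_order_def irrefl_def)
  have "f ` {1..k} = f ` {1..Suc k} - {f (Suc k)}" if "inj f" for f :: "nat \<Rightarrow> nat"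
    using that by (auto simp: inj_eq le_Suc_eq)
  then have "x ` {1..k} = y ` {1..k}" using x(1) y(1) Suc.prems(1) eq by metis
  with Suc.IH Suc.prems(4) eq show ?case by (cases "i = Suc k") auto
qed simp

section \<open>Application to the two posets sharing \<open>w\<close>\<close>

theorem theorem3p8:
  fixes n :: nat and w u :: "nat \<Rightarrow> nat"
  assumes "w permutes {1..n}" and "u permutes {1..n}"
  shows "let F = (\<lambda>lam. (insertion_map n (perm_poset n {id, w}) (perm_of_ext lam),
                         insertion_map n (perm_poset n {w, w \<circ> u}) (perm_of_ext lam)))
         in F \<in> linear_extensions n (perm_poset n {id, w, w \<circ> u})
              \<rightarrow> linear_extensions n (perm_poset n {id, w})
                 \<times> linear_extensions n (perm_poset n {w, w \<circ> u})
            \<and> inj_on F (linear_extensions n (perm_poset n {id, w, w \<circ> u}))"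
proof -
  let ?P = "perm_poset n {id, w}" and ?Q = "perm_poset n {w, w \<circ> u}"
  let ?E = "linear_extensions n (perm_poset n {id, w, w \<circ> u})"
  have P: "strict_order ?P" and Q: "strict_order ?Q"
    by (simp_all add: strict_order_def perm_poset_strict_order)
  have sub: "perm_poset n U \<subseteq> {1..n} \<times> {1..n}" for U
    by (auto simp: perm_poset_def)
  have perm: "perm_of_ext lam permutes {1..n}" if "lam \<in> ?E" for lam
    using that by (simp add: linear_extensions_def perm_of_ext_def permutes_inv)
  \<comment> \<open>Taking the union of the defining sets intersects the orders, so a pair in
    \<open>?P \<inter> ?Q\<close> is a relation respected by \<open>lam\<close>.\<close>
  have less: "i < j" if lam: "lam \<in> ?E" and ij: "(perm_of_ext lam i, perm_of_ext lam j) \<in> ?P \<inter> ?Q"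
    for lam i j
  proof -
    have "(perm_of_ext lam i, perm_of_ext lam j) \<in> perm_poset n {id, w, w \<circ> u}"
      using ij by (auto simp: perm_poset_def)
    then have "lam (inv lam i) < lam (inv lam j)"
      using lam by (auto simp: linear_extensions_def perm_of_ext_def)
    then show ?thesis
      using lam permutes_inverses(1)[of lam "{1..n}"] by (simp add: linear_extensions_def)
  qed
  have "lam = mu" if lam: "lam \<in> ?E" and mu: "mu \<in> ?E"
    and eqP: "insertion_map n ?P (perm_of_ext lam) = insertion_map n ?P (perm_of_ext mu)"
    and eqQ: "insertion_map n ?Q (perm_of_ext lam) = insertion_map n ?Q (perm_of_ext mu)" for lam mu
  proof -
    have "perm_of_ext lam i = perm_of_ext mu i" if "i \<in> {1..n}" for i
    proof (rule insertion_upto_pair_inj[where x = "perm_of_ext lam" and y = "perm_of_ext mu", OF P Q])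
      \<comment> \<open>The common member \<open>w\<close> makes \<open>inv w\<close> increase along
        both orders, so they cannot disagree in direction.\<close>
      show "(b, a) \<notin> ?Q" if "(a, b) \<in> ?P" for a b
        using that by (auto simp: perm_poset_def)
      show "inj (perm_of_ext lam)" "inj (perm_of_ext mu)"
        "perm_of_ext lam ` {1..n} = perm_of_ext mu ` {1..n}"
        using perm[OF lam] perm[OF mu] by (simp_all only: permutes_inj permutes_image)
    qed (use that eqP eqQ less[OF lam] less[OF mu] in \<open>simp_all only: insertion_map_def\<close>)
    then have "inv lam = inv mu"
      using permutes_not_in[OF perm[OF lam]] permutes_not_in[OF perm[OF mu]]
      unfolding perm_of_ext_def by (metis ext)
    then show ?thesis
      using lam mu by (metis (no_types, lifting) linear_extensions_def mem_Collect_eq permutes_inv_inv)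
  qed
  then show ?thesis
    using perm strict_order.insertion_map_linear_extension[OF P _ sub]
      strict_order.insertion_map_linear_extension[OF Q _ sub]
    by (auto simp: Let_def inj_on_def)
qed

end
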